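(* Let $\kappa\in\{1,-1\}$, $T<\infty$, and let $u,v$ be classical solutions of $i\partial_tq=-\frac12\partial_x^2q+\kappa|q|^2q$ on $[-T,T]\times\mathbb R$, with jointly continuous spatial derivatives through order two, and suppose $$\sup_{|t|\le T}\max\{p_2(u(t)),p_2(v(t))\}\le B.$$ Then there is a constant $C_{B,T}$, depending only on $B$ and $T$, such that for $L\ge1$ $$\sup_{|t|\le T}\|u(t)-v(t)\|_{H^1([-L/2,L/2])}\le C_{B,T}\Bigl(\|u(0)-v(0)\|_{H^1([-L,L])}+L^{-1/2}\Bigr).$$ For $L\ge2A+2$ (with $A>0$), the same right-hand side bounds $\sup_{|t|\le T}\|u(t)-v(t)\|_{L^\infty([-A,A])}$.
   Context: Functions are complex-valued. $p_j(f)=\max_{0\le a\le j}\|\partial_x^af\|_{L^\infty(\mathbb R)}$. *)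

theory Defs
  imports "HOL-Probability.Essential_Supremum"
begin

definition xderiv :: "(real \<Rightarrow> complex) \<Rightarrow> real \<Rightarrow> complex" where
  "xderiv f = (\<lambda>x. vector_derivative f (at x))"

text \<open>Extended-real valued, so that unbounded functions have norm \<^term>\<open>\<infinity>\<close> and suprema
  over time are genuine suprema.\<close>

definition Linf_norm :: "real set \<Rightarrow> (real \<Rightarrow> complex) \<Rightarrow> ereal" where
  "Linf_norm S f = esssup (lebesgue_on S) (\<lambda>x. ereal (cmod (f x)))"

definition p_norm :: "nat \<Rightarrow> (real \<Rightarrow> complex) \<Rightarrow> ereal" where
  "p_norm j f = Max ((\<lambda>a. Linf_norm UNIV ((xderiv ^^ a) f)) ` {0..j})"

text \<open>Stated with the classical derivative, for use on \<open>C\<^sup>1\<close> functions (where it is also the weak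
  derivative) and bounded intervals \<open>S\<close> (where the integral is finite).\<close>

definition H1_norm :: "real set \<Rightarrow> (real \<Rightarrow> complex) \<Rightarrow> real" where
  "H1_norm S f =
     sqrt ((\<integral>x. (cmod (f x))\<^sup>2 \<partial>lebesgue_on S) + (\<integral>x. (cmod (xderiv f x))\<^sup>2 \<partial>lebesgue_on S))"

text \<open>The arguments of \<open>q\<close> are time and space, in this order; values outside the time interval
  are irrelevant, and the time derivative is one-sided at \<open>\<plusminus>T\<close>. Its joint continuity
  follows from the equation.\<close>

definition classical_NLS_solution ::
  "real \<Rightarrow> real \<Rightarrow> (real \<Rightarrow> real \<Rightarrow> complex) \<Rightarrow> bool" where
  "classical_NLS_solution \<kappa> T q \<longleftrightarrow>
     (\<forall>t\<in>{-T..T}. \<forall>a<2. \<forall>x. (xderiv ^^ a) (q t) differentiable (at x)) \<and>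
     (\<forall>a\<le>2. continuous_on ({-T..T} \<times> UNIV) (\<lambda>(t, x). (xderiv ^^ a) (q t) x)) \<and>
     (\<forall>t\<in>{-T..T}. \<forall>x. \<exists>D.
        ((\<lambda>s. q s x) has_vector_derivative D) (at t within {-T..T}) \<and>
        \<i> * D = - (1 / 2) * (xderiv ^^ 2) (q t) x
                + of_real \<kappa> * of_real ((cmod (q t x))\<^sup>2) * q t x)"

end

theory Submission
  imports Defs
begin

text \<open>The difference \<open>w = u - v\<close> solves a Schroedinger equation whose forcing, together with its
  space derivative, is controlled by \<open>|w| + |w\<^sub>x|\<close>. Multiply the \<open>H\<^sup>1\<close> density by the cutoff
  \<open>\<phi>(x) = (1 - (x/L)\<^sup>2)\<^sup>2\<close> on \<open>[-L,L]\<close>. In the growth rate of the localized energy the second-order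
  terms cancel, and what remains is bounded by the energy plus terms carrying \<open>\<phi>'\<close>. Because
  \<open>|\<phi>'| \<le> 4\<surd>\<phi>/L\<close> and \<open>w\<^sub>x\<close>, \<open>w\<^sub>t\<close> are bounded, the latter cost \<open>O(1/L\<^sup>2)\<close> pointwise, hence \<open>O(1/L)\<close>
  after integration. Gronwall's inequality and \<open>\<phi> \<ge> 9/16\<close> on \<open>[-L/2,L/2]\<close> give the \<open>H\<^sup>1\<close> estimate,
  and a Sobolev inequality on unit intervals the uniform one.\<close>

section \<open>Calculus tools: diagonal derivatives, Gronwall, exact integrands\<close>

text \<open>By symmetry the partial derivative in the second argument at \<open>(s, r)\<close> is
  \<open>D r s\<close>. Continuity of \<open>D\<close> makes the two partials a total derivative,
  and along the diagonal they add up to twice the same number.\<close>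

lemma has_real_derivative_diagonal_symmetric:
  fixes K D :: "real \<Rightarrow> real \<Rightarrow> real"
  assumes sym: "\<And>s t. s \<in> U \<Longrightarrow> t \<in> U \<Longrightarrow> K s t = K t s"
    and deriv: "\<And>s t. s \<in> U \<Longrightarrow> t \<in> U \<Longrightarrow> ((\<lambda>s. K s t) has_real_derivative D s t) (at s within U)"
    and cont: "continuous_on (U \<times> U) (\<lambda>(s, t). D s t)"
    and "t \<in> U" "convex U"
  shows "((\<lambda>s. K s s) has_real_derivative 2 * D t t) (at t within U)"
proof -
  have "((\<lambda>(s, r). K s r) has_derivative (\<lambda>(ts, tr). D t t * ts + blinfun_mult_right (D t t) tr))
      (at (t, t) within U \<times> U)"
  proof (rule has_derivative_partialsI[where fy = "\<lambda>s r. blinfun_mult_right (D r s)"])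
    show "((\<lambda>s. K s t) has_derivative (\<lambda>h. D t t * h)) (at t within U)"
      using deriv[OF \<open>t \<in> U\<close> \<open>t \<in> U\<close>] by (simp add: has_field_derivative_def)
    show "((\<lambda>r. K s r) has_derivative blinfun_apply (blinfun_mult_right (D r s))) (at r within U)"
      if "s \<in> U" "r \<in> U" for s r
    proof -
      have "((\<lambda>r. K r s) has_derivative (\<lambda>h. D r s * h)) (at r within U)"
        using deriv[OF that(2,1)] by (simp add: has_field_derivative_def)
      then have "((\<lambda>r. K s r) has_derivative (\<lambda>h. D r s * h)) (at r within U)"
        by (rule has_derivative_transform[OF \<open>r \<in> U\<close>, rotated]) (use sym that in auto)
      then show ?thesis by simp
    qed
    have "continuous_on (U \<times> U) (\<lambda>p. D (snd p) (fst p))"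
      by (rule continuous_on_compose2[OF cont, where f = "\<lambda>p. (snd p, fst p)", unfolded split_beta fst_conv snd_conv])
        (auto intro!: continuous_intros)
    then have "continuous_on (U \<times> U) (\<lambda>p. blinfun_mult_right (D (snd p) (fst p)))"
      by (rule bounded_linear.continuous_on[OF bounded_linear_blinfun_mult_right])
    then show "continuous (at (t, t) within U \<times> U) (\<lambda>(s, r). blinfun_mult_right (D r s))"
      using \<open>t \<in> U\<close> by (simp add: continuous_on_eq_continuous_within case_prod_beta')
  qed (use assms in auto)
  then have "((\<lambda>(s, r). K s r) \<circ> (\<lambda>s. (s, s)) has_derivative
      (\<lambda>(ts, tr). D t t * ts + blinfun_mult_right (D t t) tr) \<circ> (\<lambda>h. (h, h))) (at t within U)"
    by (intro diff_chain_within) (auto intro!: derivative_eq_intros elim!: has_derivative_subset)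
  moreover have "(\<lambda>(ts, tr). D t t * ts + blinfun_mult_right (D t t) tr) \<circ> (\<lambda>h. (h, h)) = (*) (2 * D t t)"
    by (auto simp: fun_eq_iff algebra_simps)
  ultimately show ?thesis
    by (simp add: has_field_derivative_def o_def)
qed

text \<open>The product \<open>exp (- c * s) * g s\<close> has nonpositive derivative, so the mean
  value theorem makes its value at \<open>t\<close> at most its value at 0.\<close>

lemma gronwall_real_nonneg_time:
  fixes g g' :: "real \<Rightarrow> real"
  assumes deriv: "\<And>s. s \<in> {0..t} \<Longrightarrow> (g has_real_derivative g' s) (at s within {0..t})"
    and bound: "\<And>s. s \<in> {0..t} \<Longrightarrow> g' s \<le> c * g s" and "0 \<le> t"
  shows "g t \<le> exp (c * t) * g 0"
proof -
  have "\<exists>s\<in>{0..t}. exp (- c * t) * g t - exp (- c * 0) * g 0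
      = (\<lambda>h. (exp (- c * s) * g' s - c * exp (- c * s) * g s) * h) (t - 0)"
    using \<open>0 \<le> t\<close>
  proof (rule mvt_very_simple)
    fix s assume "0 \<le> s" "s \<le> t"
    then have "((\<lambda>s. exp (- c * s) * g s) has_real_derivative
        (exp (- c * s) * g' s - c * exp (- c * s) * g s)) (at s within {0..t})"
      by (auto intro!: derivative_eq_intros deriv simp: algebra_simps)
    then show "((\<lambda>s. exp (- c * s) * g s) has_derivative
        (\<lambda>h. (exp (- c * s) * g' s - c * exp (- c * s) * g s) * h)) (at s within {0..t})"
      by (simp add: has_field_derivative_def)
  qed
  then obtain s where s: "s \<in> {0..t}"
    and eq: "exp (- c * t) * g t - g 0 = exp (- c * s) * (g' s - c * g s) * t"
    by (auto simp: algebra_simps)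
  have "exp (- c * s) * (g' s - c * g s) * t \<le> 0"
    using bound[OF s] \<open>0 \<le> t\<close> by (simp add: mult_nonneg_nonpos mult_nonpos_nonneg)
  with eq have "exp (- c * t) * g t \<le> g 0" by linarith
  then have "exp (c * t) * (exp (- c * t) * g t) \<le> exp (c * t) * g 0" by simp
  then show ?thesis by (simp add: mult.assoc[symmetric] flip: exp_add)
qed

text \<open>The bound on the modulus of \<open>g'\<close> is invariant under time reversal, so
  negative times reduce to positive ones through \<open>g (- s)\<close>.\<close>

lemma gronwall_real_two_sided:
  fixes g g' :: "real \<Rightarrow> real"
  assumes deriv: "\<And>s. s \<in> {-T..T} \<Longrightarrow> (g has_real_derivative g' s) (at s within {-T..T})"
    and bound: "\<And>s. s \<in> {-T..T} \<Longrightarrow> \<bar>g' s\<bar> \<le> c * g s" and t: "t \<in> {-T..T}"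
  shows "g t \<le> exp (c * \<bar>t\<bar>) * g 0"
proof (cases "0 \<le> t")
  case True
  have "g t \<le> exp (c * t) * g 0"
  proof (rule gronwall_real_nonneg_time[OF _ _ True])
    fix s assume "s \<in> {0..t}"
    then show "(g has_real_derivative g' s) (at s within {0..t})"
      using t by (intro DERIV_subset[OF deriv]) auto
    show "g' s \<le> c * g s"
      using bound[of s] t \<open>s \<in> {0..t}\<close> by auto
  qed
  with True show ?thesis by simp
next
  case False
  have "g (- (- t)) \<le> exp (c * - t) * g (- 0)"
  proof (rule gronwall_real_nonneg_time[where g = "\<lambda>s. g (- s)" and g' = "\<lambda>s. - g' (- s)"])
    fix s assume s: "s \<in> {0..-t}"
    have "(g has_real_derivative g' (- s)) (at (- s) within uminus ` {0..-t})"
      using t s by (intro DERIV_subset[OF deriv]) auto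
    from DERIV_image_chain[where f = g and g = uminus, OF this DERIV_minus[OF DERIV_ident]]
    show "((\<lambda>s. g (- s)) has_real_derivative - g' (- s)) (at s within {0..-t})"
      by (simp add: o_def)
    show "- g' (- s) \<le> c * g (- s)"
      using bound[of "- s"] t s by auto
  qed (use False in auto)
  with False show ?thesis by simp
qed

text \<open>Serves as integration by parts: \<open>F\<close> will carry the cutoff as a factor and
  hence vanish at both endpoints.\<close>

lemma integral_derivative_eq_0:
  fixes F f :: "real \<Rightarrow> real"
  assumes "\<And>x. (F has_real_derivative f x) (at x)" "a \<le> b" "F a = F b"
  shows "(f has_integral 0) {a..b}"
  using fundamental_theorem_of_calculus[of a b F f] assms
  by (auto simp: has_real_derivative_iff_has_vector_derivative intro: has_vector_derivative_at_within)

lemma has_real_derivative_inner: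
  fixes f g :: "real \<Rightarrow> 'a::real_inner"
  assumes "(f has_vector_derivative f') (at x within S)" "(g has_vector_derivative g') (at x within S)"
  shows "((\<lambda>x. f x \<bullet> g x) has_real_derivative f x \<bullet> g' + f' \<bullet> g x) (at x within S)"
  using bounded_bilinear.has_vector_derivative[OF bounded_bilinear_inner assms]
  by (simp add: has_real_derivative_iff_has_vector_derivative)

section \<open>The spatial cutoff\<close>

text \<open>The square gives double zeros at the endpoints, which is what bounds the squared
  derivative by a multiple of the cutoff itself. The polynomial is not truncated, so it is smooth
  everywhere; it acts as a cutoff only because the integrals stop at the endpoints.\<close>

definition cutoff :: "real \<Rightarrow> real \<Rightarrow> real" where
  "cutoff L x = (1 - (x / L)\<^sup>2)\<^sup>2"

definition cutoff_deriv :: "real \<Rightarrow> real \<Rightarrow> real" where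
  "cutoff_deriv L x = - (4 * x / L\<^sup>2) * (1 - (x / L)\<^sup>2)"

lemma cutoff_has_derivative:
  "L \<noteq> 0 \<Longrightarrow> (cutoff L has_real_derivative cutoff_deriv L x) (at x within S)"
  unfolding cutoff_def[abs_def] cutoff_deriv_def
  by (rule derivative_eq_intros refl | simp)+ (simp add: field_simps power2_eq_square)

lemma cutoff_nonneg: "0 \<le> cutoff L x"
  by (simp add: cutoff_def)

lemma cutoff_le_1:
  assumes "x \<in> {-L..L}" "0 < L"
  shows "cutoff L x \<le> 1"
proof -
  have "(x / L)\<^sup>2 \<le> 1\<^sup>2"
    using assms by (intro iffD1[OF abs_le_square_iff]) (auto simp: abs_le_iff field_simps)
  then show ?thesis by (simp add: cutoff_def power_le_one)
qed

lemma cutoff_ge: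
  assumes "x \<in> {-(L/2)..L/2}" "0 < L"
  shows "9 / 16 \<le> cutoff L x"
proof -
  have "(x / L)\<^sup>2 \<le> (1/2)\<^sup>2"
    using assms by (intro iffD1[OF abs_le_square_iff]) (auto simp: abs_le_iff field_simps)
  then have "(3/4)\<^sup>2 \<le> (1 - (x / L)\<^sup>2)\<^sup>2"
    by (intro power_mono) (auto simp: power2_eq_square)
  then show ?thesis by (simp add: cutoff_def power2_eq_square)
qed

text \<open>The squared derivative equals the right-hand side times \<open>(x / L)\<^sup>2\<close>,
  a factor at most 1 on the interval.\<close>

lemma cutoff_deriv_squared_le:
  assumes "x \<in> {-L..L}" "0 < L"
  shows "(cutoff_deriv L x)\<^sup>2 \<le> 16 / L\<^sup>2 * cutoff L x"
proof -
  have "(x / L)\<^sup>2 \<le> 1\<^sup>2"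
    using assms by (intro iffD1[OF abs_le_square_iff]) (auto simp: abs_le_iff field_simps)
  have "(cutoff_deriv L x)\<^sup>2 = 16 / L\<^sup>2 * cutoff L x * (x / L)\<^sup>2"
    by (simp add: cutoff_deriv_def cutoff_def power_mult_distrib power_divide power2_eq_square)
  also have "\<dots> \<le> 16 / L\<^sup>2 * cutoff L x * 1"
    using \<open>(x / L)\<^sup>2 \<le> 1\<^sup>2\<close> by (intro mult_left_mono) (auto simp: cutoff_def)
  finally show ?thesis by simp
qed

lemma cutoff_endpoints: "L \<noteq> 0 \<Longrightarrow> cutoff L L = 0" "L \<noteq> 0 \<Longrightarrow> cutoff L (- L) = 0"
  by (simp_all add: cutoff_def)

lemma continuous_on_cutoff [continuous_intros]:
  "continuous_on S f \<Longrightarrow> continuous_on S (\<lambda>x. cutoff L (f x))"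
  "continuous_on S f \<Longrightarrow> continuous_on S (\<lambda>x. cutoff_deriv L (f x))"
  unfolding cutoff_def cutoff_deriv_def divide_inverse by (intro continuous_intros; assumption)+

section \<open>Pointwise algebra and estimates for the energy flux\<close>

text \<open>Read \<open>p\<close>, \<open>q\<close>, \<open>r\<close> as the difference and its
  first two space derivatives, \<open>m\<close> and \<open>l\<close> as the forcing and its space
  derivative, \<open>a\<close> and \<open>a'\<close> as the cutoff and its derivative. The first
  group on the right is then the exact derivative of
  \<open>a * (p \<bullet> (\<i> * q)) - 2 * a * (m \<bullet> q)\<close>. The quadratic term in
  \<open>r\<close> drops out because \<open>\<i> * r\<close> is orthogonal to \<open>r\<close>. The
  \<open>l\<close> terms are added and subtracted to complete that derivative.\<close>

lemma localized_energy_flux_identity: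
  fixes p q r m l :: complex
  shows "2 * ((\<i> / 2 * r + m) \<bullet> (a *\<^sub>R p - a' *\<^sub>R q - a *\<^sub>R r))
    = ((a * (p \<bullet> (\<i> * r) + q \<bullet> (\<i> * q)) + a' * (p \<bullet> (\<i> * q)))
        - 2 * (a * (m \<bullet> r + l \<bullet> q) + a' * (m \<bullet> q)))
      + (- a' * (p \<bullet> (\<i> * q)) + 2 * a * (p \<bullet> m) - 2 * a' * ((\<i> / 2 * r + m) \<bullet> q)
        + 2 * a' * (m \<bullet> q) + 2 * a * (l \<bullet> q))"
  by (simp add: inner_complex_def algebra_simps)

lemma abs_mult_le_sum_squares: "\<bar>x * y\<bar> \<le> x\<^sup>2 + (y::real)\<^sup>2"
proof -
  have "0 \<le> (\<bar>x\<bar> - \<bar>y\<bar>)\<^sup>2" by simp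
  then have "2 * \<bar>x * y\<bar> \<le> x\<^sup>2 + y\<^sup>2" by (simp add: power2_diff abs_mult)
  then show ?thesis by linarith
qed

text \<open>Young's inequality trades each cutoff derivative, of size \<open>\<surd>a/L\<close>, for a term absorbed by
  the localized energy and an error of size \<open>1/L\<^sup>2\<close>.\<close>

lemma localized_energy_flux_bound:
  fixes p q z m l :: complex
  assumes a: "0 \<le> a" "a'\<^sup>2 \<le> 16 / L\<^sup>2 * a" and K: "0 \<le> K"
    and "cmod q \<le> M" and "cmod z \<le> M" "cmod m \<le> K * cmod p" "cmod l \<le> K * (cmod p + cmod q)"
  shows "\<bar>- a' * (p \<bullet> (\<i> * q)) + 2 * a * (p \<bullet> m) - 2 * a' * (z \<bullet> q) + 2 * a' * (m \<bullet> q) + 2 * a * (l \<bullet> q)\<bar>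
    \<le> (10 + 6 * K) * (a * ((cmod p)\<^sup>2 + (cmod q)\<^sup>2)) + (3 + 2 * K\<^sup>2) * 16 * M\<^sup>2 / L\<^sup>2"
proof -
  \<comment> \<open>The factor \<open>sqrt a\<close> goes to the quantity absorbed by the energy,
    the factor \<open>4 / L\<close> to the one that is merely bounded.\<close>
  have young: "\<bar>a' * x * y\<bar> \<le> a * X\<^sup>2 + 16 / L\<^sup>2 * Y\<^sup>2" if "\<bar>x\<bar> \<le> X" "\<bar>y\<bar> \<le> Y" for x y X Y :: real
  proof -
    have "(4 / L * sqrt a)\<^sup>2 = 16 / L\<^sup>2 * a"
      using a by (simp add: power_mult_distrib power_divide)
    then have "\<bar>a'\<bar> \<le> \<bar>4 / L * sqrt a\<bar>"
      unfolding abs_le_square_iff using a(2) by simp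
    then have "\<bar>a' * x * y\<bar> \<le> \<bar>4 / L * sqrt a\<bar> * X * Y"
      unfolding abs_mult using that by (intro mult_mono) (auto intro: order_trans[OF abs_ge_zero])
    also have "\<dots> \<le> \<bar>(sqrt a * X) * (4 / L * Y)\<bar>"
      using that a by (auto simp: abs_mult ac_simps)
    also have "\<dots> \<le> (sqrt a * X)\<^sup>2 + (4 / L * Y)\<^sup>2"
      by (rule abs_mult_le_sum_squares)
    also have "\<dots> = a * X\<^sup>2 + 16 / L\<^sup>2 * Y\<^sup>2"
      using a by (simp add: power_mult_distrib power_divide)
    finally show ?thesis .
  qed
  have inner_le: "\<bar>x \<bullet> y\<bar> \<le> X * Y" if "cmod x \<le> X" "cmod y \<le> Y" for x y :: complex and X Y
  proof -
    have "cmod x * cmod y \<le> X * Y"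
      using that by (intro mult_mono) (auto intro: order_trans[OF norm_ge_zero])
    then show ?thesis using Cauchy_Schwarz_ineq2[of x y] by linarith
  qed
  have inner_young: "\<bar>a' * (x \<bullet> y)\<bar> \<le> a * X\<^sup>2 + 16 / L\<^sup>2 * Y\<^sup>2"
    if "cmod x \<le> X" "cmod y \<le> Y" for x y :: complex and X Y
  proof -
    have "\<bar>a' * (x \<bullet> y)\<bar> \<le> \<bar>a' * cmod x * cmod y\<bar>"
      using Cauchy_Schwarz_ineq2[of x y] by (simp add: abs_mult mult.assoc mult_left_mono)
    also have "\<dots> \<le> a * X\<^sup>2 + 16 / L\<^sup>2 * Y\<^sup>2"
      using that by (intro young) auto
    finally show ?thesis .
  qed
  define P Q where "P = cmod p" and "Q = cmod q"
  have PQ: "0 \<le> P" "0 \<le> Q" "P * Q \<le> P\<^sup>2 + Q\<^sup>2" "(K * M)\<^sup>2 = K\<^sup>2 * M\<^sup>2"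
    using abs_mult_le_sum_squares[of P Q] by (auto simp: P_def Q_def power_mult_distrib)
  have "\<bar>a' * (p \<bullet> (\<i> * q))\<bar> \<le> a * P\<^sup>2 + 16 / L\<^sup>2 * M\<^sup>2"
    using assms by (intro inner_young) (auto simp: P_def norm_mult)
  moreover have "\<bar>a' * (q \<bullet> z)\<bar> \<le> a * Q\<^sup>2 + 16 / L\<^sup>2 * M\<^sup>2"
    using assms by (intro inner_young) (auto simp: Q_def)
  \<comment> \<open>The factor \<open>K\<close> from the bound on \<open>m\<close> is moved to the
    bounded side, so here it affects only the error term and appears there squared.\<close>
  moreover have "\<bar>a' * (m \<bullet> q)\<bar> \<le> a * P\<^sup>2 + 16 / L\<^sup>2 * (K * M)\<^sup>2"
  proof -
    have "\<bar>m \<bullet> q\<bar> \<le> P * (K * M)"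
      using inner_le[of m "K * P" q M] assms by (simp add: P_def ac_simps)
    then have "\<bar>a' * (m \<bullet> q)\<bar> \<le> \<bar>a' * P * (K * M)\<bar>"
      using mult_left_mono[of "\<bar>m \<bullet> q\<bar>" "P * (K * M)" "\<bar>a'\<bar>"] by (simp add: abs_mult[of a'] mult.assoc)
    also have "\<dots> \<le> a * P\<^sup>2 + 16 / L\<^sup>2 * (K * M)\<^sup>2"
      using PQ K order_trans[OF norm_ge_zero assms(4)] by (intro young) (auto simp: abs_mult)
    finally show ?thesis .
  qed
  moreover have "\<bar>a * (p \<bullet> m)\<bar> \<le> K * (a * P\<^sup>2)"
    using mult_left_mono[OF inner_le[of p P m "K * P"] a(1)] assms
    by (simp add: abs_mult P_def power2_eq_square ac_simps)
  moreover have "\<bar>a * (l \<bullet> q)\<bar> \<le> K * (a * P\<^sup>2) + 2 * (K * (a * Q\<^sup>2))"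
  proof -
    have "\<bar>l \<bullet> q\<bar> \<le> K * (P + Q) * Q"
      using assms by (intro inner_le) (auto simp: P_def Q_def)
    also have "\<dots> = K * (P * Q + Q\<^sup>2)"
      by (simp add: power2_eq_square algebra_simps)
    also have "\<dots> \<le> K * (P\<^sup>2 + 2 * Q\<^sup>2)"
      using PQ K by (intro mult_left_mono) auto
    finally have "a * \<bar>l \<bullet> q\<bar> \<le> a * (K * (P\<^sup>2 + 2 * Q\<^sup>2))"
      using a by (intro mult_left_mono)
    then show ?thesis using a by (simp add: abs_mult algebra_simps)
  qed
  moreover have "0 \<le> a * P\<^sup>2" "0 \<le> a * Q\<^sup>2" "0 \<le> K * (a * P\<^sup>2)" "0 \<le> K * (a * Q\<^sup>2)"
    using a K by auto
  \<comment> \<open>Adding up gives the error coefficients 3 and 2 exactly; the energy coefficients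
    are at most 3 and, for the terms with \<open>K\<close>, 4, rounded up to 10 and 6.\<close>
  ultimately have "\<bar>- (a' * (p \<bullet> (\<i> * q))) + 2 * (a * (p \<bullet> m)) - 2 * (a' * (q \<bullet> z)) + 2 * (a' * (m \<bullet> q))
      + 2 * (a * (l \<bullet> q))\<bar>
    \<le> 10 * (a * P\<^sup>2) + 10 * (a * Q\<^sup>2) + 6 * (K * (a * P\<^sup>2)) + 6 * (K * (a * Q\<^sup>2))
      + 3 * (16 / L\<^sup>2 * M\<^sup>2) + 2 * (16 / L\<^sup>2 * (K * M)\<^sup>2)"
    by linarith
  then show ?thesis
    by (simp add: P_def Q_def PQ(4) inner_commute[of z q] algebra_simps add_divide_distrib)
qed

section \<open>Localized energy estimate for a forced Schroedinger equation\<close>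

text \<open>Isolates what the energy method needs from the difference of two solutions: a forcing
  \<open>n\<close> linearly controlled through \<open>K\<close>, and an a priori bound
  \<open>M\<close> on the space and time derivatives of \<open>w\<close>, which pays for the terms
  carrying the cutoff derivative. No time derivative of \<open>wx\<close> is postulated.\<close>

locale perturbed_schroedinger =
  fixes T L K M :: real and w wx wxx n nx :: "real \<Rightarrow> real \<Rightarrow> complex"
  assumes L: "0 < L" and K: "0 \<le> K"
    and w_dx: "\<And>t x. t \<in> {-T..T} \<Longrightarrow> (w t has_vector_derivative wx t x) (at x)"
    and wx_dx: "\<And>t x. t \<in> {-T..T} \<Longrightarrow> (wx t has_vector_derivative wxx t x) (at x)"
    and n_dx: "\<And>t x. t \<in> {-T..T} \<Longrightarrow> (n t has_vector_derivative nx t x) (at x)"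
    and w_dt: "\<And>t x. t \<in> {-T..T} \<Longrightarrow>
      ((\<lambda>s. w s x) has_vector_derivative \<i> / 2 * wxx t x + n t x) (at t within {-T..T})"
    and w_cont: "continuous_on ({-T..T} \<times> UNIV) (\<lambda>(t, x). w t x)"
    and wx_cont: "continuous_on ({-T..T} \<times> UNIV) (\<lambda>(t, x). wx t x)"
    and wxx_cont: "continuous_on ({-T..T} \<times> UNIV) (\<lambda>(t, x). wxx t x)"
    and n_cont: "continuous_on ({-T..T} \<times> UNIV) (\<lambda>(t, x). n t x)"
    and nx_cont: "continuous_on ({-T..T} \<times> UNIV) (\<lambda>(t, x). nx t x)"
    and wx_bound: "\<And>t x. t \<in> {-T..T} \<Longrightarrow> cmod (wx t x) \<le> M"
    and wt_bound: "\<And>t x. t \<in> {-T..T} \<Longrightarrow> cmod (\<i> / 2 * wxx t x + n t x) \<le> M"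
    and n_bound: "\<And>t x. t \<in> {-T..T} \<Longrightarrow> cmod (n t x) \<le> K * cmod (w t x)"
    and nx_bound: "\<And>t x. t \<in> {-T..T} \<Longrightarrow> cmod (nx t x) \<le> K * (cmod (w t x) + cmod (wx t x))"
begin

lemma continuous_on_fields:
  assumes "continuous_on S a" "continuous_on S b" "\<And>p. p \<in> S \<Longrightarrow> a p \<in> {-T..T}"
  shows "continuous_on S (\<lambda>p. w (a p) (b p))" "continuous_on S (\<lambda>p. wx (a p) (b p))"
    "continuous_on S (\<lambda>p. wxx (a p) (b p))" "continuous_on S (\<lambda>p. n (a p) (b p))"
    "continuous_on S (\<lambda>p. nx (a p) (b p))"
proof -
  have ab: "continuous_on S (\<lambda>p. (a p, b p))" "(\<lambda>p. (a p, b p)) \<in> S \<rightarrow> {-T..T} \<times> UNIV"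
    using assms by (auto intro!: continuous_intros)
  note c = continuous_on_compose2[OF _ ab(1), unfolded split_beta]
  show "continuous_on S (\<lambda>p. w (a p) (b p))" "continuous_on S (\<lambda>p. wx (a p) (b p))"
    "continuous_on S (\<lambda>p. wxx (a p) (b p))" "continuous_on S (\<lambda>p. n (a p) (b p))"
    "continuous_on S (\<lambda>p. nx (a p) (b p))"
    using c[OF w_cont] c[OF wx_cont] c[OF wxx_cont] c[OF n_cont] c[OF nx_cont] ab(2) by auto
qed

text \<open>With \<open>\<phi>\<close> the cutoff this is
  \<open>\<phi> w - (\<phi> w\<^sub>x)\<^sub>x\<close>, half the gradient of the energy with respect
  to the real inner product of square integrable functions.\<close>

definition dual :: "real \<Rightarrow> real \<Rightarrow> complex" where
  "dual t x = cutoff L x *\<^sub>R w t x - cutoff_deriv L x *\<^sub>R wx t x - cutoff L x *\<^sub>R wxx t x"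

definition energy :: "real \<Rightarrow> real" where
  "energy t = integral {-L..L} (\<lambda>x. cutoff L x * ((cmod (w t x))\<^sup>2 + (cmod (wx t x))\<^sup>2))"

text \<open>What is left of twice the inner product of the time derivative of \<open>w\<close> with
  \<open>dual\<close> once an exact space derivative is removed.\<close>

definition flux :: "real \<Rightarrow> real \<Rightarrow> real" where
  "flux t x = - cutoff_deriv L x * (w t x \<bullet> (\<i> * wx t x)) + 2 * cutoff L x * (w t x \<bullet> n t x)
    - 2 * cutoff_deriv L x * ((\<i> / 2 * wxx t x + n t x) \<bullet> wx t x)
    + 2 * cutoff_deriv L x * (n t x \<bullet> wx t x) + 2 * cutoff L x * (nx t x \<bullet> wx t x)"

text \<open>The two integrands differ by the derivative of
  \<open>cutoff L x * (w s x \<bullet> wx t x)\<close>, which vanishes at the endpoints. The two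
  times stay independent: the left side involves time \<open>s\<close> only through
  \<open>w\<close>, while the right side is symmetric in the times.\<close>

lemma has_integral_w_inner_dual:
  assumes s: "s \<in> {-T..T}" and t: "t \<in> {-T..T}"
  shows "((\<lambda>x. w s x \<bullet> dual t x) has_integral
    integral {-L..L} (\<lambda>x. cutoff L x * (w s x \<bullet> w t x + wx s x \<bullet> wx t x))) {-L..L}"
proof -
  let ?b = "\<lambda>x. cutoff L x * (w s x \<bullet> wxx t x + wx s x \<bullet> wx t x) + cutoff_deriv L x * (w s x \<bullet> wx t x)"
  let ?e = "\<lambda>x. cutoff L x * (w s x \<bullet> w t x + wx s x \<bullet> wx t x)"
  have "(?b has_integral 0) {-L..L}"
  proof (rule integral_derivative_eq_0)
    show "((\<lambda>x. cutoff L x * (w s x \<bullet> wx t x)) has_real_derivative ?b x) (at x)" for x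
      by (rule DERIV_cong[OF DERIV_mult'[OF cutoff_has_derivative
            has_real_derivative_inner[OF w_dx[OF s] wx_dx[OF t]]]]) (use L in auto)
  qed (use L cutoff_endpoints[of L] in auto)
  moreover have "(?e has_integral integral {-L..L} ?e) {-L..L}"
    using s t by (intro integrable_integral integrable_continuous_interval continuous_intros
      continuous_on_fields) auto
  ultimately have "((\<lambda>x. ?e x - ?b x) has_integral integral {-L..L} ?e - 0) {-L..L}"
    by (rule has_integral_diff[rotated])
  moreover have "(\<lambda>x. ?e x - ?b x) = (\<lambda>x. w s x \<bullet> dual t x)"
    by (simp add: dual_def inner_simps algebra_simps fun_eq_iff)
  ultimately show ?thesis by simp
qed

text \<open>The exact group of \<open>localized_energy_flux_identity\<close> integrates to zero.
  This shifts a space derivative onto the forcing and leaves \<open>wxx\<close> only inside the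
  bounded time derivative of \<open>w\<close>.\<close>

lemma has_integral_flux:
  assumes t: "t \<in> {-T..T}"
  shows "(flux t has_integral 2 * integral {-L..L} (\<lambda>x. (\<i> / 2 * wxx t x + n t x) \<bullet> dual t x)) {-L..L}"
proof -
  let ?b = "\<lambda>x. (cutoff L x * (w t x \<bullet> (\<i> * wxx t x) + wx t x \<bullet> (\<i> * wx t x))
        + cutoff_deriv L x * (w t x \<bullet> (\<i> * wx t x)))
      - 2 * (cutoff L x * (n t x \<bullet> wxx t x + nx t x \<bullet> wx t x) + cutoff_deriv L x * (n t x \<bullet> wx t x))"
  have "(?b has_integral 0) {-L..L}"
  proof (rule integral_derivative_eq_0)
    show "((\<lambda>x. cutoff L x * (w t x \<bullet> (\<i> * wx t x)) - 2 * (cutoff L x * (n t x \<bullet> wx t x)))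
        has_real_derivative ?b x) (at x)" for x
      by (rule DERIV_cong[OF DERIV_diff[OF
            DERIV_mult'[OF cutoff_has_derivative
              has_real_derivative_inner[OF w_dx[OF t] has_vector_derivative_mult_right[OF wx_dx[OF t]]]]
            DERIV_cmult[OF DERIV_mult'[OF cutoff_has_derivative
              has_real_derivative_inner[OF n_dx[OF t] wx_dx[OF t]]]]]]) (use L in auto)
  qed (use L cutoff_endpoints[of L] in auto)
  moreover have "((\<lambda>x. 2 * ((\<i> / 2 * wxx t x + n t x) \<bullet> dual t x)) has_integral
      2 * integral {-L..L} (\<lambda>x. (\<i> / 2 * wxx t x + n t x) \<bullet> dual t x)) {-L..L}"
    unfolding dual_def using t
    by (intro has_integral_mult_right integrable_integral integrable_continuous_interval
      continuous_intros continuous_on_fields) auto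
  ultimately have "((\<lambda>x. 2 * ((\<i> / 2 * wxx t x + n t x) \<bullet> dual t x) - ?b x) has_integral
      2 * integral {-L..L} (\<lambda>x. (\<i> / 2 * wxx t x + n t x) \<bullet> dual t x) - 0) {-L..L}"
    by (rule has_integral_diff[rotated])
  moreover have "2 * ((\<i> / 2 * wxx t x + n t x) \<bullet> dual t x) - ?b x = flux t x" for x
    unfolding dual_def flux_def localized_energy_flux_identity[where l = "nx t x"] by simp
  ultimately show ?thesis by simp
qed

text \<open>The mixed derivative \<open>w\<^sub>x\<^sub>t\<close> need not exist. The energy is therefore differentiated as the
  diagonal of a symmetric form in two times, which integration by parts makes an integral of \<open>w\<close>
  at one time against \<^const>\<open>dual\<close> at the other.\<close>

lemma energy_has_derivative:
  assumes t: "t \<in> {-T..T}"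
  shows "(energy has_real_derivative integral {-L..L} (flux t)) (at t within {-T..T})"
proof -
  let ?J = "\<lambda>s t. integral {-L..L} (\<lambda>x. w s x \<bullet> dual t x)"
  let ?D = "\<lambda>s t. integral {-L..L} (\<lambda>x. (\<i> / 2 * wxx s x + n s x) \<bullet> dual t x)"
  have J: "?J s t = integral {-L..L} (\<lambda>x. cutoff L x * (w s x \<bullet> w t x + wx s x \<bullet> wx t x))"
    if "s \<in> {-T..T}" "t \<in> {-T..T}" for s t
    using has_integral_w_inner_dual[OF that] by (rule integral_unique)
  have "((\<lambda>s. ?J s s) has_real_derivative 2 * ?D t t) (at t within {-T..T})"
  proof (rule has_real_derivative_diagonal_symmetric[where K = ?J and D = ?D])
    show "?J s t = ?J t s" if "s \<in> {-T..T}" "t \<in> {-T..T}" for s t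
      using that by (simp add: J inner_commute)
    show "((\<lambda>s. ?J s t) has_real_derivative ?D s t) (at s within {-T..T})"
      if st: "s \<in> {-T..T}" "t \<in> {-T..T}" for s t
      unfolding has_real_derivative_iff_has_vector_derivative interval_cbox
    \<comment> \<open>With \<open>t\<close> frozen, \<open>dual t\<close> is constant in time, so
      differentiating under the integral uses only \<open>w_dt\<close>.\<close>
    proof (rule leibniz_rule_vector_derivative[where fx = "\<lambda>s x. (\<i> / 2 * wxx s x + n s x) \<bullet> dual t x"])
      fix r x assume "r \<in> cbox (-T) T"
      then have r: "r \<in> {-T..T}" by simp
      have "((\<lambda>s. w s x \<bullet> dual t x) has_vector_derivative (\<i> / 2 * wxx r x + n r x) \<bullet> dual t x) (at r within {-T..T})"
        using has_real_derivative_inner[OF w_dt[OF r] has_vector_derivative_const]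
        by (simp add: has_real_derivative_iff_has_vector_derivative)
      then show "((\<lambda>s. w s x \<bullet> dual t x) has_vector_derivative (\<i> / 2 * wxx r x + n r x) \<bullet> dual t x)
          (at r within cbox (-T) T)" by simp
    next
      fix r assume "r \<in> cbox (-T) T"
      then show "(\<lambda>x. w r x \<bullet> dual t x) integrable_on cbox (-L) L"
        using has_integral_w_inner_dual[of r t] st by (auto simp: integrable_on_def)
    next
      show "continuous_on (cbox (-T) T \<times> cbox (-L) L) (\<lambda>(s, x). (\<i> / 2 * wxx s x + n s x) \<bullet> dual t x)"
        unfolding dual_def split_beta using st
        by (intro continuous_intros continuous_on_fields) auto
    qed (use st in auto)
    have "continuous_on ({-T..T} \<times> {-T..T})
        (\<lambda>p. integral (cbox (-L) L) (\<lambda>x. (\<i> / 2 * wxx (fst p) x + n (fst p) x) \<bullet> dual (snd p) x))"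
      unfolding dual_def
      by (rule integral_continuous_on_param, unfold split_beta, intro continuous_intros continuous_on_fields) auto
    then show "continuous_on ({-T..T} \<times> {-T..T}) (\<lambda>(s, t). ?D s t)"
      by (simp add: case_prod_beta')
  qed (use t in auto)
  moreover have "?J s s = energy s" if "s \<in> {-T..T}" for s
    using that by (simp add: J energy_def power2_norm_eq_inner)
  ultimately have "(energy has_real_derivative 2 * ?D t t) (at t within {-T..T})"
    unfolding has_field_derivative_def
    by (intro has_derivative_transform[OF t, of energy "\<lambda>s. ?J s s"]) auto
  then show ?thesis
    using has_integral_flux[OF t] by (simp add: integral_unique)
qed

lemma energy_density_integrable:
  "t \<in> {-T..T} \<Longrightarrow>
    (\<lambda>x. cutoff L x * ((cmod (w t x))\<^sup>2 + (cmod (wx t x))\<^sup>2)) integrable_on {-L..L}"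
  by (intro integrable_continuous_interval continuous_intros continuous_on_fields) auto

lemma energy_nonneg: "t \<in> {-T..T} \<Longrightarrow> 0 \<le> energy t"
  unfolding energy_def by (intro integral_nonneg energy_density_integrable) (auto simp: cutoff_nonneg)

text \<open>Integrates the pointwise flux bound. Over an interval of length \<open>2 * L\<close> the
  error of order \<open>1 / L\<^sup>2\<close> becomes one of order \<open>1 / L\<close>, and 16
  becomes 32.\<close>

lemma energy_derivative_bound:
  assumes t: "t \<in> {-T..T}"
  shows "\<bar>integral {-L..L} (flux t)\<bar> \<le> (10 + 6 * K) * energy t + (3 + 2 * K\<^sup>2) * 32 * M\<^sup>2 / L"
proof -
  let ?e = "\<lambda>x. cutoff L x * ((cmod (w t x))\<^sup>2 + (cmod (wx t x))\<^sup>2)"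
  let ?d = "(3 + 2 * K\<^sup>2) * 16 * M\<^sup>2 / L\<^sup>2"
  note e = energy_density_integrable[OF t]
  have "norm (integral {-L..L} (flux t)) \<le> integral {-L..L} (\<lambda>x. (10 + 6 * K) * ?e x + ?d)"
  proof (rule integral_norm_bound_integral)
    show "flux t integrable_on {-L..L}"
      using has_integral_flux[OF t] by (auto simp: integrable_on_def)
    show "norm (flux t x) \<le> (10 + 6 * K) * ?e x + ?d" if "x \<in> {-L..L}" for x
      unfolding flux_def real_norm_def
      by (rule localized_energy_flux_bound[OF cutoff_nonneg cutoff_deriv_squared_le[OF that L] K
            wx_bound[OF t] wt_bound[OF t] n_bound[OF t] nx_bound[OF t]])
  qed (intro integrable_add integrable_on_mult_right e integrable_const_ivl)
  also have "\<dots> = (10 + 6 * K) * energy t + 2 * L * ?d"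
    using e L by (subst integral_add) (auto simp: energy_def integrable_on_mult_right)
  also have "2 * L * ?d = (3 + 2 * K\<^sup>2) * 32 * M\<^sup>2 / L"
    using L by (simp add: power2_eq_square field_simps)
  finally show ?thesis by simp
qed

text \<open>Adding \<open>1 / L\<close> to the energy makes the differential inequality homogeneous:
  \<open>c\<close> is the sum of its two coefficients, and the extra cross terms are nonnegative.
  Gronwall then applies in both time directions.\<close>

lemma energy_growth:
  assumes t: "t \<in> {-T..T}"
  defines "c \<equiv> (10 + 6 * K) + (3 + 2 * K\<^sup>2) * 32 * M\<^sup>2"
  shows "energy t + 1 / L \<le> exp (c * T) * (energy 0 + 1 / L)"
proof -
  have T: "0 \<in> {-T..T}" using t by auto
  have "0 \<le> c" using K by (simp add: c_def)
  have "energy t + 1 / L \<le> exp (c * \<bar>t\<bar>) * (energy 0 + 1 / L)"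
  proof (rule gronwall_real_two_sided[OF _ _ t])
    fix s assume s: "s \<in> {-T..T}"
    show "((\<lambda>s. energy s + 1 / L) has_real_derivative integral {-L..L} (flux s)) (at s within {-T..T})"
      using energy_has_derivative[OF s] by (auto intro!: derivative_eq_intros)
    have "0 \<le> (3 + 2 * K\<^sup>2) * 32 * M\<^sup>2 * energy s + (10 + 6 * K) * (1 / L)"
      using energy_nonneg[OF s] K L by auto
    then show "\<bar>integral {-L..L} (flux s)\<bar> \<le> c * (energy s + 1 / L)"
      using energy_derivative_bound[OF s] by (simp add: c_def algebra_simps add_divide_distrib)
  qed
  also have "\<dots> \<le> exp (c * T) * (energy 0 + 1 / L)"
    using t \<open>0 \<le> c\<close> energy_nonneg[OF T] L by (intro mult_right_mono) (auto intro!: mult_left_mono)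
  finally show ?thesis .
qed

text \<open>The cutoff is at least 9/16 on the inner interval, whence the factor
  \<open>16 / 9\<close>, and at most 1 on the outer one, which removes it at time 0.\<close>

lemma H1_integral_bound:
  assumes t: "t \<in> {-T..T}"
  defines "c \<equiv> (10 + 6 * K) + (3 + 2 * K\<^sup>2) * 32 * M\<^sup>2"
  shows "integral {-(L/2)..L/2} (\<lambda>x. (cmod (w t x))\<^sup>2 + (cmod (wx t x))\<^sup>2)
    \<le> 16 / 9 * exp (c * T) * (integral {-L..L} (\<lambda>x. (cmod (w 0 x))\<^sup>2 + (cmod (wx 0 x))\<^sup>2) + 1 / L)"
proof -
  have T: "0 \<in> {-T..T}" using t by auto
  let ?f = "\<lambda>t x. (cmod (w t x))\<^sup>2 + (cmod (wx t x))\<^sup>2"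
  have int: "?f s integrable_on {a..b}" if "s \<in> {-T..T}" for s a b
    using that by (intro integrable_continuous_interval continuous_intros continuous_on_fields) auto
  have "integral {-(L/2)..L/2} (?f t) \<le> integral {-(L/2)..L/2} (\<lambda>x. 16 / 9 * (cutoff L x * ?f t x))"
  proof (rule integral_le[OF int[OF t]])
    show "(\<lambda>x. 16 / 9 * (cutoff L x * ?f t x)) integrable_on {-(L/2)..L/2}"
      using t by (intro integrable_continuous_interval continuous_intros continuous_on_fields) auto
    show "?f t x \<le> 16 / 9 * (cutoff L x * ?f t x)" if "x \<in> {-(L/2)..L/2}" for x
      using mult_right_mono[OF cutoff_ge[OF that L], of "?f t x"] by simp
  qed
  also have "\<dots> \<le> integral {-L..L} (\<lambda>x. 16 / 9 * (cutoff L x * ?f t x))"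
    using L t by (intro integral_subset_le integrable_continuous_interval continuous_intros
      continuous_on_fields) (auto intro!: mult_nonneg_nonneg cutoff_nonneg)
  also have "\<dots> = 16 / 9 * energy t"
    by (simp add: energy_def)
  also have "\<dots> \<le> 16 / 9 * (exp (c * T) * (energy 0 + 1 / L))"
  proof -
    have "0 < 1 / L" using L by simp
    then show ?thesis using energy_growth[OF t, folded c_def] by linarith
  qed
  also have "\<dots> \<le> 16 / 9 * (exp (c * T) * (integral {-L..L} (?f 0) + 1 / L))"
  proof -
    have "energy 0 \<le> integral {-L..L} (?f 0)"
      unfolding energy_def
    proof (rule integral_le[OF energy_density_integrable[OF T] int[OF T]])
      show "cutoff L x * ?f 0 x \<le> ?f 0 x" if "x \<in> {-L..L}" for x
        using mult_right_mono[OF cutoff_le_1[OF that L], of "?f 0 x"] by simp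
    qed
    then show ?thesis by simp
  qed
  finally show ?thesis by (simp add: mult.assoc)
qed

end

section \<open>Sobolev inequality on unit intervals\<close>

text \<open>The function \<open>(x + 1 - y) * (f y \<bullet> f y)\<close> of \<open>y\<close> is the
  squared modulus of \<open>f x\<close> at \<open>y = x\<close> and zero at
  \<open>y = x + 1\<close>. Minus its derivative is at most twice the density, since the weight lies
  between 0 and 1.\<close>

lemma sobolev_unit_interval:
  fixes f f' :: "real \<Rightarrow> complex"
  assumes deriv: "\<And>x. (f has_vector_derivative f' x) (at x)" and cont: "continuous_on UNIV f'"
    and sub: "{x..x+1} \<subseteq> {a..b}"
  shows "(cmod (f x))\<^sup>2 \<le> 2 * integral {a..b} (\<lambda>y. (cmod (f y))\<^sup>2 + (cmod (f' y))\<^sup>2)"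
proof -
  let ?h = "\<lambda>y. (cmod (f y))\<^sup>2 + (cmod (f' y))\<^sup>2"
  have f: "continuous_on UNIV f"
    using deriv by (auto intro: has_vector_derivative_continuous continuous_at_imp_continuous_on)
  have h: "?h integrable_on {c..d}" for c d
    by (intro integrable_continuous_interval continuous_intros continuous_on_subset[OF f]
      continuous_on_subset[OF cont]) auto
  let ?g = "\<lambda>y. (x + 1 - y) * (f y \<bullet> f' y + f' y \<bullet> f y) - f y \<bullet> f y"
  have "((\<lambda>y. (x + 1 - y) * (f y \<bullet> f y)) has_real_derivative ?g y) (at y)" for y
    by (rule DERIV_cong[OF DERIV_mult'[OF DERIV_diff[OF DERIV_const DERIV_ident]
          has_real_derivative_inner[OF deriv deriv]]]) simp
  then have "(?g has_integral (x + 1 - (x + 1)) * (f (x + 1) \<bullet> f (x + 1)) - (x + 1 - x) * (f x \<bullet> f x)) {x..x+1}"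
    by (intro fundamental_theorem_of_calculus)
      (auto simp flip: has_real_derivative_iff_has_vector_derivative intro: has_field_derivative_at_within)
  then have "((\<lambda>y. - ?g y) has_integral (cmod (f x))\<^sup>2) {x..x+1}"
    by (auto dest: has_integral_neg simp: power2_norm_eq_inner)
  then have "(cmod (f x))\<^sup>2 \<le> integral {x..x+1} (\<lambda>y. 2 * ?h y)"
  proof (rule has_integral_le[OF _ integrable_integral])
    show "(\<lambda>y. 2 * ?h y) integrable_on {x..x+1}"
      by (intro integrable_on_mult_right h)
    fix y assume y: "y \<in> {x..x+1}"
    have "\<bar>f y \<bullet> f' y + f' y \<bullet> f y\<bar> \<le> ?h y"
    proof -
      have "2 * (cmod (f y) * cmod (f' y)) \<le> ?h y"
        using sum_squares_bound[of "cmod (f y)" "cmod (f' y)"] by simp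
      then show ?thesis
        using Cauchy_Schwarz_ineq2[of "f y" "f' y"] by (simp add: inner_commute)
    qed
    then have "\<bar>x + 1 - y\<bar> * \<bar>f y \<bullet> f' y + f' y \<bullet> f y\<bar> \<le> 1 * ?h y"
      using y by (intro mult_mono) auto
    then have "- ((x + 1 - y) * (f y \<bullet> f' y + f' y \<bullet> f y)) \<le> ?h y"
      by (simp flip: abs_mult)
    then show "- ?g y \<le> 2 * ?h y"
      using inner_ge_zero[of "f' y"] unfolding power2_norm_eq_inner by argo
  qed
  also have "\<dots> = 2 * integral {x..x+1} ?h"
    by (rule integral_mult_right)
  also have "\<dots> \<le> 2 * integral {a..b} ?h"
    using sub h by (intro mult_left_mono integral_subset_le) auto
  finally show ?thesis .
qed

section \<open>Lipschitz bounds for the cubic nonlinearity\<close>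

text \<open>Written with the real inner product so that the real product rules and Cauchy-Schwarz
  apply directly.\<close>

definition cubic :: "complex \<Rightarrow> complex" where
  "cubic z = (z \<bullet> z) *\<^sub>R z"

text \<open>The real Frechet derivative of \<open>cubic\<close> at \<open>z\<close> in direction
  \<open>h\<close>; it is real-linear in \<open>h\<close>, but in general not
  complex-linear.\<close>

definition cubic_deriv :: "complex \<Rightarrow> complex \<Rightarrow> complex" where
  "cubic_deriv z h = (2 * (z \<bullet> h)) *\<^sub>R z + (z \<bullet> z) *\<^sub>R h"

lemma cubic_has_vector_derivative:
  assumes "(f has_vector_derivative f') (at x)"
  shows "((\<lambda>x. cubic (f x)) has_vector_derivative cubic_deriv (f x) f') (at x)"
  using has_vector_derivative_scaleR[OF has_real_derivative_inner[OF assms assms] assms]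
  by (simp add: cubic_def cubic_deriv_def inner_commute algebra_simps)

lemma norm_inner_scaleR_le:
  assumes "cmod x \<le> X" "cmod y \<le> Y" "cmod z \<le> Z"
  shows "cmod ((x \<bullet> y) *\<^sub>R z) \<le> X * Y * Z"
proof -
  have "cmod ((x \<bullet> y) *\<^sub>R z) \<le> cmod x * cmod y * cmod z"
    using Cauchy_Schwarz_ineq2[of x y] by (simp add: mult_right_mono)
  also have "\<dots> \<le> X * Y * Z"
    using assms order_trans[OF norm_ge_zero assms(1)] order_trans[OF norm_ge_zero assms(2)]
    by (intro mult_mono) auto
  finally show ?thesis .
qed

text \<open>Telescoping with
  \<open>u \<bullet> u - v \<bullet> v = (u - v) \<bullet> (u + v)\<close> leaves a factor
  \<open>u - v\<close> in each term; the coefficients are \<open>B\<^sup>2\<close> and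
  \<open>2 * B\<^sup>2\<close>.\<close>

lemma cubic_diff_le:
  assumes "cmod u \<le> B" "cmod v \<le> B"
  shows "cmod (cubic u - cubic v) \<le> 3 * B\<^sup>2 * cmod (u - v)"
proof -
  have eq: "cubic u - cubic v = (u \<bullet> u) *\<^sub>R (u - v) + ((u - v) \<bullet> (u + v)) *\<^sub>R v"
    by (simp add: cubic_def inner_simps inner_commute algebra_simps)
  have "cmod (u + v) \<le> 2 * B"
    using norm_triangle_ineq[of u v] assms by linarith
  then have "cmod (cubic u - cubic v) \<le> B * B * cmod (u - v) + cmod (u - v) * (2 * B) * B"
    unfolding eq using assms by (intro norm_triangle_mono norm_inner_scaleR_le) auto
  then show ?thesis by (simp add: power2_eq_square algebra_simps)
qed

text \<open>Telescoping leaves in each trilinear term exactly one factor \<open>u - v\<close> or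
  \<open>h - k\<close>. The totals are \<open>6 * B\<^sup>2\<close> and
  \<open>3 * B\<^sup>2\<close>; the larger is taken for both.\<close>

lemma cubic_deriv_diff_le:
  assumes "cmod u \<le> B" "cmod v \<le> B" "cmod h \<le> B" "cmod k \<le> B"
  shows "cmod (cubic_deriv u h - cubic_deriv v k) \<le> 6 * B\<^sup>2 * (cmod (u - v) + cmod (h - k))"
proof -
  have eq: "cubic_deriv u h - cubic_deriv v k = 2 *\<^sub>R (((u - v) \<bullet> h) *\<^sub>R u
      + (v \<bullet> (h - k)) *\<^sub>R u + (v \<bullet> k) *\<^sub>R (u - v))
      + ((u \<bullet> u) *\<^sub>R (h - k) + ((u - v) \<bullet> (u + v)) *\<^sub>R k)"
    by (simp add: cubic_deriv_def inner_simps inner_commute algebra_simps)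
  have "cmod (u + v) \<le> 2 * B"
    using norm_triangle_ineq[of u v] assms by linarith
  moreover have "cmod (((u - v) \<bullet> h) *\<^sub>R u + (v \<bullet> (h - k)) *\<^sub>R u + (v \<bullet> k) *\<^sub>R (u - v))
      \<le> cmod (u - v) * B * B + B * cmod (h - k) * B + B * B * cmod (u - v)"
    using assms by (intro norm_triangle_mono norm_inner_scaleR_le) auto
  ultimately have "cmod (cubic_deriv u h - cubic_deriv v k) \<le>
      2 * (cmod (u - v) * B * B + B * cmod (h - k) * B + B * B * cmod (u - v))
      + (B * B * cmod (h - k) + cmod (u - v) * (2 * B) * B)"
    unfolding eq using assms by (intro norm_triangle_mono norm_inner_scaleR_le) auto
  also have "\<dots> = 6 * B\<^sup>2 * cmod (u - v) + 3 * B\<^sup>2 * cmod (h - k)"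
    by (simp add: power2_eq_square algebra_simps)
  also have "\<dots> \<le> 6 * B\<^sup>2 * (cmod (u - v) + cmod (h - k))"
    by (simp add: algebra_simps)
  finally show ?thesis .
qed

section \<open>From norms to pointwise bounds and integrals\<close>

text \<open>The set where the bound holds is closed by continuity and has full measure, so it is the
  whole line.\<close>

lemma cmod_le_Linf_norm:
  assumes "Linf_norm UNIV f \<le> ereal B" "continuous_on UNIV f"
  shows "cmod (f x) \<le> B"
proof -
  have "AE x in lebesgue. ereal (cmod (f x)) \<le> Linf_norm UNIV f"
    unfolding Linf_norm_def lebesgue_on_UNIV_eq by (rule esssup_AE)
  then have "AE x in lebesgue. x \<in> {x. cmod (f x) \<le> B}"
    by eventually_elim (use assms(1) order_trans in fastforce)
  moreover have "closed {x. cmod (f x) \<le> B}"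
    using assms(2) by (intro closed_Collect_le continuous_intros)
  ultimately show ?thesis
    using mem_closed_if_AE_lebesgue[of "{x. cmod (f x) \<le> B}" x] by blast
qed

lemma Linf_norm_le:
  assumes "S \<in> sets lebesgue" "continuous_on S f" "\<And>x. x \<in> S \<Longrightarrow> cmod (f x) \<le> c"
  shows "Linf_norm S f \<le> ereal c"
  unfolding Linf_norm_def
proof (rule esssup_I)
  show "(\<lambda>x. ereal (cmod (f x))) \<in> borel_measurable (lebesgue_on S)"
    using assms by (intro borel_measurable_ereal continuous_imp_measurable_on_sets_lebesgue continuous_intros)
  show "AE x in lebesgue_on S. ereal (cmod (f x)) \<le> ereal c"
    using assms by (intro AE_I2) auto
qed

text \<open>Translates the Lebesgue integrals and \<open>xderiv\<close> of the norm into the gauge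
  integral and explicit derivative used in the estimates.\<close>

lemma H1_norm_interval:
  assumes deriv: "\<And>x. (f has_vector_derivative f' x) (at x)" and cont: "continuous_on UNIV f'"
  shows "H1_norm {a..b} f = sqrt (integral {a..b} (\<lambda>x. (cmod (f x))\<^sup>2 + (cmod (f' x))\<^sup>2))"
proof -
  have f': "xderiv f = f'"
    using deriv by (auto simp: xderiv_def fun_eq_iff intro: vector_derivative_at)
  have "continuous_on UNIV f"
    using deriv by (auto intro: has_vector_derivative_continuous continuous_at_imp_continuous_on)
  then have c: "continuous_on {a..b} (\<lambda>x. (cmod (f x))\<^sup>2)" "continuous_on {a..b} (\<lambda>x. (cmod (f' x))\<^sup>2)"
    using cont by (auto intro!: continuous_intros intro: continuous_on_subset)
  then show ?thesis
    unfolding H1_norm_def f'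
    by (simp add: lebesgue_integral_eq_integral continuous_imp_integrable_real integral_add integrable_continuous_interval)
qed

lemma p_norm_2_bound:
  assumes "p_norm 2 f \<le> ereal B" "a \<le> 2" "continuous_on UNIV ((xderiv ^^ a) f)"
  shows "cmod ((xderiv ^^ a) f x) \<le> B"
proof (rule cmod_le_Linf_norm[OF _ assms(3)])
  have "Linf_norm UNIV ((xderiv ^^ a) f) \<le> p_norm 2 f"
    unfolding p_norm_def using assms(2) by (intro Max_ge) auto
  then show "Linf_norm UNIV ((xderiv ^^ a) f) \<le> ereal B"
    using assms(1) by order
qed

section \<open>Classical solutions and the equation for their difference\<close>

lemma classical_NLS_solutionD:
  assumes "classical_NLS_solution \<kappa> T q" "t \<in> {-T..T}"
  shows "(q t has_vector_derivative xderiv (q t) x) (at x)"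
    and "(xderiv (q t) has_vector_derivative (xderiv ^^ 2) (q t) x) (at x)"
    and "((\<lambda>s. q s x) has_vector_derivative \<i> / 2 * (xderiv ^^ 2) (q t) x - \<i> * of_real \<kappa> * cubic (q t x))
      (at t within {-T..T})"
    and "a \<le> 2 \<Longrightarrow> continuous_on UNIV ((xderiv ^^ a) (q t))"
proof -
  have diff: "(xderiv ^^ a) (q t) differentiable (at x)" if "a < 2" for a
    using assms that by (auto simp: classical_NLS_solution_def)
  have "q t differentiable (at x)" "xderiv (q t) differentiable (at x)"
    using diff[of 0] diff[of 1] by auto
  then show "(q t has_vector_derivative xderiv (q t) x) (at x)"
    and "(xderiv (q t) has_vector_derivative (xderiv ^^ 2) (q t) x) (at x)"
    by (simp_all add: vector_derivative_works xderiv_def numeral_2_eq_2)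
  obtain D where D: "((\<lambda>s. q s x) has_vector_derivative D) (at t within {-T..T})"
    and eq: "\<i> * D = - (1 / 2) * (xderiv ^^ 2) (q t) x
      + of_real \<kappa> * of_real ((cmod (q t x))\<^sup>2) * q t x"
    using assms unfolding classical_NLS_solution_def by blast
  \<comment> \<open>Multiplying by \<open>- \<i>\<close> solves the equation for the time
    derivative.\<close>
  have "D = - (\<i> * (\<i> * D))" by simp
  also have "\<dots> = \<i> / 2 * (xderiv ^^ 2) (q t) x - \<i> * of_real \<kappa> * cubic (q t x)"
    unfolding eq by (simp add: cubic_def scaleR_conv_of_real power2_norm_eq_inner algebra_simps)
  finally show "((\<lambda>s. q s x) has_vector_derivative
      \<i> / 2 * (xderiv ^^ 2) (q t) x - \<i> * of_real \<kappa> * cubic (q t x)) (at t within {-T..T})"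
    using D by simp
  show "continuous_on UNIV ((xderiv ^^ a) (q t))" if "a \<le> 2"
  proof -
    have "continuous_on ({-T..T} \<times> UNIV) (\<lambda>(t, x). (xderiv ^^ a) (q t) x)"
      using assms that by (auto simp: classical_NLS_solution_def)
    moreover have "continuous_on UNIV (\<lambda>x::real. (t, x))"
      by (intro continuous_intros)
    ultimately show ?thesis
      using continuous_on_compose2[of _ _ UNIV "\<lambda>x. (t, x)"] assms(2) by fastforce
  qed
qed

lemma classical_NLS_solution_continuous:
  assumes "classical_NLS_solution \<kappa> T q"
  shows "continuous_on ({-T..T} \<times> UNIV) (\<lambda>p. q (fst p) (snd p))"
    and "continuous_on ({-T..T} \<times> UNIV) (\<lambda>p. xderiv (q (fst p)) (snd p))"
    and "continuous_on ({-T..T} \<times> UNIV) (\<lambda>p. (xderiv ^^ 2) (q (fst p)) (snd p))"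
proof -
  have c: "continuous_on ({-T..T} \<times> UNIV) (\<lambda>p. (xderiv ^^ a) (q (fst p)) (snd p))" if "a \<le> 2" for a
    using assms that by (auto simp: classical_NLS_solution_def split_beta)
  show "continuous_on ({-T..T} \<times> UNIV) (\<lambda>p. q (fst p) (snd p))"
    "continuous_on ({-T..T} \<times> UNIV) (\<lambda>p. xderiv (q (fst p)) (snd p))"
    "continuous_on ({-T..T} \<times> UNIV) (\<lambda>p. (xderiv ^^ 2) (q (fst p)) (snd p))"
    using c[of 0] c[of 1] c[of 2] by auto
qed

text \<open>\<open>6 * B\<^sup>2\<close> covers the Lipschitz constants of both \<open>cubic\<close>
  and its derivative. \<open>2 * B + 6 * B ^ 3\<close> covers the bound \<open>2 * B\<close> on the
  difference of the space derivatives and \<open>B + 6 * B ^ 3\<close> on that of the time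
  derivatives.\<close>

lemma NLS_difference_perturbed_schroedinger:
  assumes \<kappa>: "\<bar>\<kappa>\<bar> = 1" and L: "0 < L"
    and u: "classical_NLS_solution \<kappa> T u" and v: "classical_NLS_solution \<kappa> T v"
    and bound: "\<And>t. t \<in> {-T..T} \<Longrightarrow> p_norm 2 (u t) \<le> ereal B" "\<And>t. t \<in> {-T..T} \<Longrightarrow> p_norm 2 (v t) \<le> ereal B"
  shows "perturbed_schroedinger T L (6 * B\<^sup>2) (2 * B + 6 * B ^ 3) (\<lambda>t x. u t x - v t x)
    (\<lambda>t x. xderiv (u t) x - xderiv (v t) x) (\<lambda>t x. (xderiv ^^ 2) (u t) x - (xderiv ^^ 2) (v t) x)
    (\<lambda>t x. - \<i> * of_real \<kappa> * (cubic (u t x) - cubic (v t x)))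
    (\<lambda>t x. - \<i> * of_real \<kappa> * (cubic_deriv (u t x) (xderiv (u t) x) - cubic_deriv (v t x) (xderiv (v t) x)))"
proof -
  note uD = classical_NLS_solutionD[OF u] and vD = classical_NLS_solutionD[OF v]
  have b: "cmod (u t x) \<le> B" "cmod (v t x) \<le> B" "cmod (xderiv (u t) x) \<le> B" "cmod (xderiv (v t) x) \<le> B"
    "cmod ((xderiv ^^ 2) (u t) x) \<le> B" "cmod ((xderiv ^^ 2) (v t) x) \<le> B" if t: "t \<in> {-T..T}" for t x
    using p_norm_2_bound[OF bound(1)[OF t] _ uD(4)[OF t], of 0] p_norm_2_bound[OF bound(1)[OF t] _ uD(4)[OF t], of 1]
      p_norm_2_bound[OF bound(1)[OF t] _ uD(4)[OF t], of 2]
      p_norm_2_bound[OF bound(2)[OF t] _ vD(4)[OF t], of 0] p_norm_2_bound[OF bound(2)[OF t] _ vD(4)[OF t], of 1]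
      p_norm_2_bound[OF bound(2)[OF t] _ vD(4)[OF t], of 2]
    by simp_all
  note cont = classical_NLS_solution_continuous[OF u] classical_NLS_solution_continuous[OF v]
  \<comment> \<open>The coefficient of the forcing has modulus 1, so the focusing and defocusing
    equations share all bounds.\<close>
  have n: "cmod (- \<i> * of_real \<kappa> * z) = cmod z" for z
    using \<kappa> by (simp add: norm_mult)
  have n_le: "cmod (cubic (u t x) - cubic (v t x)) \<le> 3 * B\<^sup>2 * cmod (u t x - v t x)" if "t \<in> {-T..T}" for t x
    using b[OF that] by (intro cubic_diff_le)
  show ?thesis
  proof (unfold_locales, unfold n split_beta)
    fix t x assume t: "t \<in> {-T..T}"
    have "0 \<le> B" using order_trans[OF norm_ge_zero b(1)[OF t]] .
    show "((\<lambda>x. u t x - v t x) has_vector_derivative xderiv (u t) x - xderiv (v t) x) (at x)"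
      "((\<lambda>x. xderiv (u t) x - xderiv (v t) x) has_vector_derivative
        (xderiv ^^ 2) (u t) x - (xderiv ^^ 2) (v t) x) (at x)"
      by (intro has_vector_derivative_diff uD vD t)+
    show "((\<lambda>x. - \<i> * of_real \<kappa> * (cubic (u t x) - cubic (v t x))) has_vector_derivative
        - \<i> * of_real \<kappa> * (cubic_deriv (u t x) (xderiv (u t) x) - cubic_deriv (v t x) (xderiv (v t) x))) (at x)"
      by (intro has_vector_derivative_mult_right has_vector_derivative_diff cubic_has_vector_derivative uD vD t)
    show "((\<lambda>s. u s x - v s x) has_vector_derivative \<i> / 2 * ((xderiv ^^ 2) (u t) x - (xderiv ^^ 2) (v t) x)
        + - \<i> * of_real \<kappa> * (cubic (u t x) - cubic (v t x))) (at t within {-T..T})"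
      by (rule has_vector_derivative_eq_rhs[OF has_vector_derivative_diff[OF uD(3)[OF t] vD(3)[OF t]]])
        (simp add: algebra_simps)
    have d: "cmod (u t x - v t x) \<le> 2 * B" "cmod (xderiv (u t) x - xderiv (v t) x) \<le> 2 * B"
      "cmod ((xderiv ^^ 2) (u t) x - (xderiv ^^ 2) (v t) x) \<le> 2 * B"
      using b[OF t] norm_triangle_le_diff[of _ _ "2 * B"] by (smt (verit))+
    show "cmod (xderiv (u t) x - xderiv (v t) x) \<le> 2 * B + 6 * B ^ 3"
      using d \<open>0 \<le> B\<close> by (smt (verit) zero_le_power)
    show "cmod (cubic (u t x) - cubic (v t x)) \<le> 6 * B\<^sup>2 * cmod (u t x - v t x)"
      by (rule order_trans[OF n_le[OF t] mult_right_mono]) auto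
    show "cmod (cubic_deriv (u t x) (xderiv (u t) x) - cubic_deriv (v t x) (xderiv (v t) x))
      \<le> 6 * B\<^sup>2 * (cmod (u t x - v t x) + cmod (xderiv (u t) x - xderiv (v t) x))"
      using b[OF t] by (intro cubic_deriv_diff_le)
    have "cmod (\<i> / 2 * ((xderiv ^^ 2) (u t) x - (xderiv ^^ 2) (v t) x)
        + - \<i> * of_real \<kappa> * (cubic (u t x) - cubic (v t x)))
      \<le> 1 / 2 * (2 * B) + 3 * B\<^sup>2 * (2 * B)"
      unfolding n norm_mult[of "\<i> / 2"]
    proof (rule norm_triangle_mono)
      show "cmod (\<i> / 2 * ((xderiv ^^ 2) (u t) x - (xderiv ^^ 2) (v t) x)) \<le> 1 / 2 * (2 * B)"
        using d(3) by (simp add: norm_mult)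
      show "cmod (- \<i> * of_real \<kappa> * (cubic (u t x) - cubic (v t x))) \<le> 3 * B\<^sup>2 * (2 * B)"
        unfolding n by (rule order_trans[OF n_le[OF t] mult_left_mono[OF d(1)]]) simp
    qed
    also have "\<dots> \<le> 2 * B + 6 * B ^ 3"
      using \<open>0 \<le> B\<close> by (simp add: power2_eq_square power3_eq_cube)
    finally show "cmod (\<i> / 2 * ((xderiv ^^ 2) (u t) x - (xderiv ^^ 2) (v t) x)
        + - \<i> * of_real \<kappa> * (cubic (u t x) - cubic (v t x))) \<le> 2 * B + 6 * B ^ 3" .
  qed (use L cont in \<open>auto simp: cubic_def cubic_deriv_def intro!: continuous_intros\<close>)
qed

section \<open>Stability in the Sobolev and uniform norms\<close>

text \<open>Square root of \<open>H1_integral_bound\<close>: subadditivity of the root separates the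
  initial norm from \<open>sqrt (1 / L)\<close>. Here \<open>c\<close> is the energy constant for
  the values of \<open>K\<close> and \<open>M\<close> belonging to the difference.\<close>

lemma NLS_stability_H1:
  fixes B T :: real
  defines "c \<equiv> (10 + 6 * (6 * B\<^sup>2)) + (3 + 2 * (6 * B\<^sup>2)\<^sup>2) * 32 * (2 * B + 6 * B ^ 3)\<^sup>2"
  assumes \<kappa>: "\<bar>\<kappa>\<bar> = 1" and L: "0 < L" and t: "t \<in> {-T..T}"
    and u: "classical_NLS_solution \<kappa> T u" and v: "classical_NLS_solution \<kappa> T v"
    and bound: "\<And>t. t \<in> {-T..T} \<Longrightarrow> p_norm 2 (u t) \<le> ereal B" "\<And>t. t \<in> {-T..T} \<Longrightarrow> p_norm 2 (v t) \<le> ereal B"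
  shows "H1_norm {-(L/2)..L/2} (\<lambda>x. u t x - v t x)
    \<le> sqrt (16 / 9 * exp (c * T)) * (H1_norm {-L..L} (\<lambda>x. u 0 x - v 0 x) + L powr (-1/2))"
proof -
  interpret perturbed_schroedinger T L "6 * B\<^sup>2" "2 * B + 6 * B ^ 3" "\<lambda>t x. u t x - v t x"
    "\<lambda>t x. xderiv (u t) x - xderiv (v t) x" "\<lambda>t x. (xderiv ^^ 2) (u t) x - (xderiv ^^ 2) (v t) x"
    "\<lambda>t x. - \<i> * of_real \<kappa> * (cubic (u t x) - cubic (v t x))"
    "\<lambda>t x. - \<i> * of_real \<kappa> * (cubic_deriv (u t x) (xderiv (u t) x) - cubic_deriv (v t x) (xderiv (v t) x))"
    by (rule NLS_difference_perturbed_schroedinger[OF \<kappa> L u v bound])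
  let ?I = "\<lambda>t a b. integral {a..b} (\<lambda>x. (cmod (u t x - v t x))\<^sup>2 + (cmod (xderiv (u t) x - xderiv (v t) x))\<^sup>2)"
  have H1: "H1_norm {a..b} (\<lambda>x. u t x - v t x) = sqrt (?I t a b)" if "t \<in> {-T..T}" for t a b
    using w_dx[OF that] wx_dx[OF that]
    by (intro H1_norm_interval) (auto intro: has_vector_derivative_continuous continuous_at_imp_continuous_on)
  have "0 \<in> {-T..T}" using t by auto
  \<comment> \<open>A non-integrable function has \<open>integral\<close> 0 by default, so both
    cases give nonnegativity.\<close>
  have "0 \<le> ?I 0 (-L) L"
    by (cases "(\<lambda>x. (cmod (u 0 x - v 0 x))\<^sup>2 + (cmod (xderiv (u 0) x - xderiv (v 0) x))\<^sup>2) integrable_on {-L..L}")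
      (auto simp: not_integrable_integral intro: integral_nonneg)
  have powr: "L powr (-1/2) = sqrt (1 / L)"
    using L by (simp add: powr_minus powr_half_sqrt real_sqrt_divide inverse_eq_divide)
  have "sqrt (?I t (-(L/2)) (L/2)) \<le> sqrt (16 / 9 * exp (c * T) * (?I 0 (-L) L + 1 / L))"
    using H1_integral_bound[OF t] by (simp only: c_def real_sqrt_le_iff)
  also have "\<dots> = sqrt (16 / 9 * exp (c * T)) * sqrt (?I 0 (-L) L + 1 / L)"
    by (rule real_sqrt_mult)
  also have "\<dots> \<le> sqrt (16 / 9 * exp (c * T)) * (sqrt (?I 0 (-L) L) + sqrt (1 / L))"
    using L \<open>0 \<le> ?I 0 (-L) L\<close> by (intro mult_left_mono sqrt_add_le_add_sqrt) auto
  finally show ?thesis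
    by (simp only: H1[OF t] H1[OF \<open>0 \<in> {-T..T}\<close>] powr)
qed

text \<open>Square root of \<open>sobolev_unit_interval\<close>, with \<open>sqrt 2\<close> rounded
  up to 2.\<close>

lemma cmod_le_H1_norm:
  assumes deriv: "\<And>x. (f has_vector_derivative f' x) (at x)" and cont: "continuous_on UNIV f'"
    and sub: "{x..x+1} \<subseteq> {a..b}"
  shows "cmod (f x) \<le> 2 * H1_norm {a..b} f"
proof -
  let ?I = "integral {a..b} (\<lambda>x. (cmod (f x))\<^sup>2 + (cmod (f' x))\<^sup>2)"
  have "cmod (f x) \<le> sqrt (2 * ?I)"
    using sobolev_unit_interval[OF assms] by (rule real_le_rsqrt)
  also have "\<dots> = sqrt 2 * H1_norm {a..b} f"
    using H1_norm_interval[OF deriv cont] by (simp add: real_sqrt_mult)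
  also have "\<dots> \<le> 2 * H1_norm {a..b} f"
    by (intro mult_right_mono) (auto simp: H1_norm_def sqrt2_less_2 less_imp_le)
  finally show ?thesis .
qed

theorem proposition45:
  fixes B T :: real
  assumes "0 \<le> T"
  shows "\<exists>C::real. 0 < C \<and>
    (\<forall>\<kappa>::real. \<forall>u v :: real \<Rightarrow> real \<Rightarrow> complex.
       \<kappa> \<in> {1, -1} \<longrightarrow>
       classical_NLS_solution \<kappa> T u \<longrightarrow>
       classical_NLS_solution \<kappa> T v \<longrightarrow>
       (SUP t\<in>{-T..T}. max (p_norm 2 (u t)) (p_norm 2 (v t))) \<le> ereal B \<longrightarrow>
       (\<forall>L::real. 1 \<le> L \<longrightarrow>
          (SUP t\<in>{-T..T}. ereal (H1_norm {-(L/2)..L/2} (\<lambda>x. u t x - v t x)))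
            \<le> ereal (C * (H1_norm {-L..L} (\<lambda>x. u 0 x - v 0 x) + L powr (-1/2)))) \<and>
       (\<forall>A L::real. 0 < A \<longrightarrow> 2 * A + 2 \<le> L \<longrightarrow>
          (SUP t\<in>{-T..T}. Linf_norm {-A..A} (\<lambda>x. u t x - v t x))
            \<le> ereal (C * (H1_norm {-L..L} (\<lambda>x. u 0 x - v 0 x) + L powr (-1/2)))))"
proof -
  \<comment> \<open>Both constants are fixed before the solutions, the sign and the lengths:
    \<open>c\<close> involves only \<open>B\<close>, and \<open>C\<close> only \<open>B\<close> and
    \<open>T\<close>.\<close>
  define c where "c = (10 + 6 * (6 * B\<^sup>2)) + (3 + 2 * (6 * B\<^sup>2)\<^sup>2) * 32 * (2 * B + 6 * B ^ 3)\<^sup>2"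
  define C where "C = sqrt (16 / 9 * exp (c * T))"
  have "0 < C" by (simp add: C_def)
  show ?thesis
  \<comment> \<open>\<open>C\<close> suffices for the Sobolev norm; the factor 2 is the one lost in
    \<open>cmod_le_H1_norm\<close>, so a single constant serves both estimates.\<close>
  proof (intro exI[of _ "2 * C"] conjI allI impI)
    show "0 < 2 * C" using \<open>0 < C\<close> by simp
    fix \<kappa> :: real and u v :: "real \<Rightarrow> real \<Rightarrow> complex"
    assume "\<kappa> \<in> {1, -1}" and u: "classical_NLS_solution \<kappa> T u" and v: "classical_NLS_solution \<kappa> T v"
      and B: "(SUP t\<in>{-T..T}. max (p_norm 2 (u t)) (p_norm 2 (v t))) \<le> ereal B"
    then have \<kappa>: "\<bar>\<kappa>\<bar> = 1" by auto
    have bound: "p_norm 2 (u t) \<le> ereal B" "p_norm 2 (v t) \<le> ereal B" if "t \<in> {-T..T}" for t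
      using B that unfolding SUP_le_iff by auto
    let ?w = "\<lambda>t x. u t x - v t x"
    let ?R = "\<lambda>L. H1_norm {-L..L} (?w 0) + L powr (-1/2)"
    have R: "0 \<le> ?R L" for L by (simp add: H1_norm_def)
    have H1: "H1_norm {-(L/2)..L/2} (?w t) \<le> C * ?R L" if "0 < L" "t \<in> {-T..T}" for t L
      unfolding C_def c_def by (rule NLS_stability_H1[OF \<kappa> that u v bound])
    show "(SUP t\<in>{-T..T}. ereal (H1_norm {-(L/2)..L/2} (?w t))) \<le> ereal (2 * C * ?R L)"
      if "1 \<le> L" for L
    proof (rule SUP_least)
      fix t assume "t \<in> {-T..T}"
      with H1[of L t] that have "H1_norm {-(L/2)..L/2} (?w t) \<le> C * ?R L" by simp
      also have "\<dots> \<le> 2 * C * ?R L"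
        using \<open>0 < C\<close> R by (intro mult_right_mono) auto
      finally show "ereal (H1_norm {-(L/2)..L/2} (?w t)) \<le> ereal (2 * C * ?R L)" by simp
    qed
    show "(SUP t\<in>{-T..T}. Linf_norm {-A..A} (?w t)) \<le> ereal (2 * C * ?R L)"
      if "0 < A" "2 * A + 2 \<le> L" for A L
    proof (rule SUP_least, rule Linf_norm_le)
      fix t assume t: "t \<in> {-T..T}"
      have deriv: "(?w t has_vector_derivative xderiv (u t) x - xderiv (v t) x) (at x)" for x
        by (intro has_vector_derivative_diff classical_NLS_solutionD[OF u t] classical_NLS_solutionD[OF v t])
      then show "continuous_on {-A..A} (?w t)"
        by (auto intro: has_vector_derivative_continuous continuous_at_imp_continuous_on)
      have cont: "continuous_on UNIV (\<lambda>x. xderiv (u t) x - xderiv (v t) x)"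
        using classical_NLS_solutionD(4)[OF u t, of 1] classical_NLS_solutionD(4)[OF v t, of 1]
        by (intro continuous_on_diff) auto
      show "cmod (?w t x) \<le> 2 * C * ?R L" if x: "x \<in> {-A..A}" for x
      proof -
        \<comment> \<open>Since \<open>A + 1 \<le> L / 2\<close>, the unit interval to the right of
          any point of \<open>{-A..A}\<close> stays inside \<open>{-(L/2)..L/2}\<close>.\<close>
        have "cmod (?w t x) \<le> 2 * H1_norm {-(L/2)..L/2} (?w t)"
          using x \<open>2 * A + 2 \<le> L\<close> by (intro cmod_le_H1_norm[OF deriv cont]) auto
        also have "\<dots> \<le> 2 * (C * ?R L)"
          using H1[of L t] t that \<open>0 < A\<close> \<open>2 * A + 2 \<le> L\<close> by simp
        finally show ?thesis by (simp add: mult.assoc)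
      qed
    qed auto
  qed
qed

end
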